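(* For $n=2$ buyers, in every market, the best response dynamic of the All-or-Nothing mechanism starting from any strategy profile converges to a pure Nash equilibrium.
   Context: Market: a linear multi-unit market $\mathcal{M}=(\mathbf{v},\mathbf{B},m)$ has buyers $N=\{1,\dots,n\}$ and one seller with $m$ indivisible identical units. Buyer $i$ has budget $B_i>0$ and per-unit valuation $v_i$. The utility of buyer $i$ for $k$ units at unit price $p$ is $u_i(p,k)=v_ik-pk$ if $pk\le B_i$ and $-\infty$ otherwise. The demand set $D_i(p)$ is $\{\min\{\lfloor B_i/p\rfloor,m\}\}$ if $v_i>p$ (hungry); $\{0,1,\dots,\min\{\lfloor B_i/p\rfloor,m\}\}$ if $v_i=p$ (semi-hungry); and $\{0\}$ if $v_i<p$ (uninterested). An outcome $(\mathbf{x},p)$ with $x_i\in\mathbb{Z}_{\ge 0}$ and $\sum_i x_i\le m$ is an envy-free pricing if $x_i\in D_i(p)$ for all $i$, and then $p$ is an envy-free price; price $0$ is not regarded as an envy-free price. Discrete domain: valuations, reports and budgets lie in $\mathbb{V}=\{k\epsilon: k\in\mathbb{N}\}$ for some fixed $\epsilon>0$, and prices are chosen from $\mathbb{W}=\{k\delta:k\in\mathbb{N}\}$ for some fixed $\delta>0$. All-or-Nothing mechanism: given the reported valuations (budgets and $m$ are known), let $p$ be the minimum envy-free price with respect to the reports. Every hungry buyer gets its demand; every buyer with reported value $<p$ gets $0$; the semi-hungry buyers are taken in lexicographic order and each such buyer $i$ gets $x_i=\lfloor B_i/p\rfloor$ if possible (enough units remain), and otherwise $x_i=0$. Strategies: a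 strategy of buyer $i$ is a reported valuation $s_i\in\mathbb{V}$; its utility at a profile $\mathbf{s}$ is computed with its true valuation $v_i$ and the outcome of the mechanism on $\mathbf{s}$. A profile is a pure Nash equilibrium if no buyer can strictly improve its utility by changing its own report. Best response dynamic: starting from an initial profile, at each step some buyer (in arbitrary order) who can strictly improve its utility changes its report to one maximizing its utility given the current reports of the others. The dynamic converges if after finitely many steps no buyer can strictly improve. *)

theory Defs
  imports Complex_Main "HOL-Library.Extended_Real"
begin

text \<open>The buyers are \<open>1, \<dots>, num_buyers M\<close>; the values of \<open>valuation M\<close> and \<open>budget M\<close>
  at other indices play no role.\<close>

record market =
  num_buyers :: nat
  valuation :: "nat \<Rightarrow> real"
  budget :: "nat \<Rightarrow> real"
  units :: nat

definition buyers :: "market \<Rightarrow> nat set" where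
  "buyers M = {1..num_buyers M}"

definition affordable :: "market \<Rightarrow> real \<Rightarrow> nat \<Rightarrow> nat" where
  "affordable M p i = nat \<lfloor>budget M i / p\<rfloor>"

definition max_demand :: "market \<Rightarrow> real \<Rightarrow> nat \<Rightarrow> nat" where
  "max_demand M p i = min (affordable M p i) (units M)"

definition demand_set :: "market \<Rightarrow> real \<Rightarrow> nat \<Rightarrow> nat set" where
  "demand_set M p i =
     (if valuation M i > p then {max_demand M p i}
      else if valuation M i = p then {0..max_demand M p i}
      else {0})"

definition utility :: "market \<Rightarrow> nat \<Rightarrow> real \<Rightarrow> nat \<Rightarrow> ereal" where
  "utility M i p k =
     (if p * real k \<le> budget M i then ereal (valuation M i * real k - p * real k) else -\<infinity>)"

definition envy_free_pricing :: "market \<Rightarrow> (nat \<Rightarrow> nat) \<Rightarrow> real \<Rightarrow> bool" where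
  "envy_free_pricing M x p \<longleftrightarrow>
     p > 0 \<and> (\<Sum>i\<in>buyers M. x i) \<le> units M \<and> (\<forall>i\<in>buyers M. x i \<in> demand_set M p i)"

definition envy_free_price :: "market \<Rightarrow> real \<Rightarrow> bool" where
  "envy_free_price M p \<longleftrightarrow> (\<exists>x. envy_free_pricing M x p)"

definition grid :: "real \<Rightarrow> real set" where
  "grid \<epsilon> = {real k * \<epsilon> | k. True}"

text \<open>The mechanism on a market whose valuations are the reported ones, with prices in \<open>grid \<delta>\<close>.
  The \<open>LEAST\<close> below is attained for every \<open>\<delta> > 0\<close>, see \<open>min_price_envy_free\<close>.\<close>

definition min_price :: "real \<Rightarrow> market \<Rightarrow> real" where
  "min_price \<delta> M = (LEAST p. p \<in> grid \<delta> \<and> envy_free_price M p)"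

text \<open>\<open>units_left p M k\<close> is the number of units remaining once all hungry buyers and the
  semi-hungry ones among \<open>1, \<dots>, k\<close> have been served. The subtraction in the base case does not
  truncate when \<open>p\<close> is an envy-free price.\<close>

primrec units_left :: "real \<Rightarrow> market \<Rightarrow> nat \<Rightarrow> nat" where
  "units_left p M 0 =
     units M - (\<Sum>i\<in>{i \<in> buyers M. valuation M i > p}. max_demand M p i)"
| "units_left p M (Suc k) =
     (if valuation M (Suc k) = p \<and> affordable M p (Suc k) \<le> units_left p M k
      then units_left p M k - affordable M p (Suc k)
      else units_left p M k)"

definition all_or_nothing_alloc :: "real \<Rightarrow> market \<Rightarrow> nat \<Rightarrow> nat" where
  "all_or_nothing_alloc p M i =
     (if valuation M i > p then max_demand M p i
      else if valuation M i = p \<and> affordable M p i \<le> units_left p M (i - 1) then affordable M p i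
      else 0)"

text \<open>In the following, \<open>M\<close> is the true market and \<open>s\<close> the profile of reports: the outcome is that
  of the reported market \<open>M\<lparr>valuation := s\<rparr>\<close>, evaluated with the true valuations.\<close>

definition outcome_utility :: "real \<Rightarrow> market \<Rightarrow> nat \<Rightarrow> (nat \<Rightarrow> real) \<Rightarrow> ereal" where
  "outcome_utility \<delta> M i s =
     (let R = M\<lparr>valuation := s\<rparr>; p = min_price \<delta> R
      in utility M i p (all_or_nothing_alloc p R i))"

definition strategy_profile :: "real \<Rightarrow> market \<Rightarrow> (nat \<Rightarrow> real) \<Rightarrow> bool" where
  "strategy_profile \<epsilon> M s \<longleftrightarrow> (\<forall>i\<in>buyers M. s i \<in> grid \<epsilon>)"

definition can_improve :: "real \<Rightarrow> real \<Rightarrow> market \<Rightarrow> nat \<Rightarrow> (nat \<Rightarrow> real) \<Rightarrow> bool" where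
  "can_improve \<epsilon> \<delta> M i s \<longleftrightarrow>
     (\<exists>r\<in>grid \<epsilon>. outcome_utility \<delta> M i (s(i := r)) > outcome_utility \<delta> M i s)"

definition best_response ::
  "real \<Rightarrow> real \<Rightarrow> market \<Rightarrow> nat \<Rightarrow> (nat \<Rightarrow> real) \<Rightarrow> real \<Rightarrow> bool" where
  "best_response \<epsilon> \<delta> M i s r \<longleftrightarrow>
     r \<in> grid \<epsilon> \<and>
     (\<forall>r'\<in>grid \<epsilon>. outcome_utility \<delta> M i (s(i := r')) \<le> outcome_utility \<delta> M i (s(i := r)))"

definition pure_nash_equilibrium :: "real \<Rightarrow> real \<Rightarrow> market \<Rightarrow> (nat \<Rightarrow> real) \<Rightarrow> bool" where
  "pure_nash_equilibrium \<epsilon> \<delta> M s \<longleftrightarrow>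
     strategy_profile \<epsilon> M s \<and> (\<forall>i\<in>buyers M. \<not> can_improve \<epsilon> \<delta> M i s)"

definition best_response_step ::
  "real \<Rightarrow> real \<Rightarrow> market \<Rightarrow> (nat \<Rightarrow> real) \<Rightarrow> (nat \<Rightarrow> real) \<Rightarrow> bool" where
  "best_response_step \<epsilon> \<delta> M s s' \<longleftrightarrow>
     (\<exists>i\<in>buyers M. can_improve \<epsilon> \<delta> M i s \<and> (\<exists>r. best_response \<epsilon> \<delta> M i s r \<and> s' = s(i := r)))"

text \<open>Buyers move in arbitrary order and may pick any best response, so convergence is required of
  every run: none is infinite, and a run that cannot be continued has reached an equilibrium. The
  second condition excludes runs that stop only because an improving buyer has no best response.\<close>

definition best_response_converges ::
  "real \<Rightarrow> real \<Rightarrow> market \<Rightarrow> (nat \<Rightarrow> real) \<Rightarrow> bool" where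
  "best_response_converges \<epsilon> \<delta> M s0 \<longleftrightarrow>
     (\<nexists>\<sigma>. \<sigma> 0 = s0 \<and> (\<forall>t::nat. best_response_step \<epsilon> \<delta> M (\<sigma> t) (\<sigma> (Suc t)))) \<and>
     (\<forall>s. (best_response_step \<epsilon> \<delta> M)\<^sup>*\<^sup>* s0 s \<and> (\<nexists>s'. best_response_step \<epsilon> \<delta> M s s')
        \<longrightarrow> pure_nash_equilibrium \<epsilon> \<delta> M s)"

definition discrete_market :: "real \<Rightarrow> market \<Rightarrow> bool" where
  "discrete_market \<epsilon> M \<longleftrightarrow>
     (\<forall>i\<in>buyers M. valuation M i \<in> grid \<epsilon> \<and> budget M i \<in> grid \<epsilon> \<and> budget M i > 0)"

lemma min_price_envy_free:
  assumes "\<delta> > 0"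
  shows "min_price \<delta> M \<in> grid \<delta> \<and> envy_free_price M (min_price \<delta> M)"
    and "p \<in> grid \<delta> \<Longrightarrow> envy_free_price M p \<Longrightarrow> min_price \<delta> M \<le> p"
proof -
  let ?Q = "\<lambda>p. p \<in> grid \<delta> \<and> envy_free_price M p"
  define c where "c = Max (insert 0 (valuation M ` buyers M))"
  obtain k0 :: nat where k0: "c < real k0 * \<delta>"
    using ex_less_of_nat_mult[OF assms] by blast
  have fin: "finite (insert 0 (valuation M ` buyers M))" by (simp add: buyers_def)
  have c: "0 \<le> c" "\<And>i. i \<in> buyers M \<Longrightarrow> valuation M i \<le> c"
    unfolding c_def using fin by (auto intro!: Max_ge)
  have "envy_free_pricing M (\<lambda>_. 0) (real k0 * \<delta>)"
    using k0 c by (fastforce simp: envy_free_pricing_def demand_set_def)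
  then have ex: "?Q (real k0 * \<delta>)" by (auto simp: grid_def envy_free_price_def)
  define k where "k = (LEAST k. ?Q (real k * \<delta>))"
  have k: "?Q (real k * \<delta>)" unfolding k_def by (rule LeastI[of "\<lambda>k. ?Q (real k * \<delta>)", OF ex])
  have le: "real k * \<delta> \<le> q" if q: "?Q q" for q
  proof -
    obtain j where j: "q = real j * \<delta>" using q by (auto simp: grid_def)
    have "k \<le> j" unfolding k_def by (rule Least_le) (use q j in simp)
    then show ?thesis using assms j by (simp add: mult_right_mono)
  qed
  have eq: "min_price \<delta> M = real k * \<delta>"
    unfolding min_price_def by (rule Least_equality) (use k le in blast)+
  show "?Q (min_price \<delta> M)" using k eq by simp
  show "p \<in> grid \<delta> \<Longrightarrow> envy_free_price M p \<Longrightarrow> min_price \<delta> M \<le> p"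
    using le[of p] eq by simp
qed

end

theory Submission
  imports Defs
begin

text \<open>
  If the other buyer reports \<open>t\<close>, then buyer \<open>i\<close> faces a threshold price \<open>Q t\<close>: a report above it
  yields the full demand at price \<open>Q t\<close>, and a report below it yields nothing, because at every
  smaller price the two demands together exceed the supply and the all-or-nothing rule refuses the
  semi-hungry buyer. Hence an improving best response either raises the report from at most \<open>Q t\<close>
  to at least \<open>Q t\<close> (when \<open>Q t < v\<^sub>i\<close>), or lowers it from at least \<open>Q t\<close> to at most \<open>Q t\<close>
  (when \<open>v\<^sub>i < Q t\<close>). In an infinite run the two buyers alternate. A buyer who always raises stays
  below its valuation, and a buyer who always lowers stays nonnegative, so on the grid neither can
  go on forever. But if a buyer raises and later lowers, some price \<open>c\<close> strictly between the two
  valuations separates the reports from then on, so that this buyer can only lower.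
\<close>

section \<open>Monotone sequences on a grid\<close>

lemma grid_scale: "x \<in> grid \<epsilon> \<Longrightarrow> \<exists>k::nat. x = real k * \<epsilon>"
  by (auto simp: grid_def)

lemma zero_in_grid: "0 \<in> grid \<epsilon>"
  unfolding grid_def by (auto intro: exI[of _ 0])

lemma grid_unbounded:
  assumes "\<epsilon> > 0"
  shows "\<exists>r\<in>grid \<epsilon>. c < r"
  using ex_less_of_nat_mult[OF assms, of c] by (auto simp: grid_def)

lemma no_decreasing_grid_sequence:
  assumes "\<epsilon> > 0" "\<And>n::nat. f n \<in> grid \<epsilon>" "\<And>n. f (Suc n) < f n"
  shows False
proof -
  obtain k :: "nat \<Rightarrow> nat" where k: "\<And>n. f n = real (k n) * \<epsilon>"
    using grid_scale[OF assms(2)] by metis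
  have "k (Suc n) < k n" for n
    using assms(3)[of n] assms(1) by (simp add: k)
  then show False
    using wf_iff_no_infinite_down_chain[of less_than] by auto
qed

lemma no_bounded_increasing_grid_sequence:
  assumes "\<epsilon> > 0" "\<And>n::nat. f n \<in> grid \<epsilon>" "\<And>n. f n < f (Suc n)" "\<And>n. f n \<le> c"
  shows False
proof -
  obtain k :: "nat \<Rightarrow> nat" where k: "\<And>n. f n = real (k n) * \<epsilon>"
    using grid_scale[OF assms(2)] by metis
  have "strict_mono k"
    using assms(1,3) by (simp add: strict_mono_Suc_iff k)
  then have "real n * \<epsilon> \<le> c" for n
    using strict_mono_imp_increasing[of k n] assms(1) assms(4)[of n]
    by (smt (verit) k mult_right_mono of_nat_le_iff)
  then show False
    using ex_less_of_nat_mult[OF assms(1), of c] by (meson not_le)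
qed

section \<open>Demand and allocation in arbitrary markets\<close>

lemma units_left_le: "units_left p M k \<le> units M"
  by (induction k) auto

lemma max_demand_affordable:
  assumes "p > 0" "budget M i \<ge> 0"
  shows "p * real (max_demand M p i) \<le> budget M i"
proof -
  have "real (max_demand M p i) \<le> real (nat \<lfloor>budget M i / p\<rfloor>)"
    by (simp add: max_demand_def affordable_def)
  also have "\<dots> \<le> budget M i / p"
    using assms by simp
  finally show ?thesis
    using assms by (simp add: field_simps)
qed

lemma affordable_reports [simp]: "affordable (M\<lparr>valuation := s\<rparr>) p i = affordable M p i"
  by (simp add: affordable_def)

lemma max_demand_reports [simp]: "max_demand (M\<lparr>valuation := s\<rparr>) p i = max_demand M p i"
  by (simp add: max_demand_def)

lemma buyers_reports [simp]: "buyers (M\<lparr>valuation := s\<rparr>) = buyers M"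
  by (simp add: buyers_def)

text \<open>The mechanism grants \<open>affordable\<close>, which is not capped by the supply. It
  does so only if that amount fits into the units left, and then the cap in
  \<open>max_demand\<close> is not binding.\<close>

lemma semi_hungry_alloc:
  assumes "valuation M i = p"
  shows "all_or_nothing_alloc p M i \<in> {0, max_demand M p i}"
proof -
  have "affordable M p i \<le> units_left p M (i - 1) \<Longrightarrow> affordable M p i \<le> units M"
    using units_left_le le_trans by blast
  then show ?thesis
    using assms by (auto simp: all_or_nothing_alloc_def max_demand_def)
qed

section \<open>Two buyers and the threshold price\<close>

locale two_buyers =
  fixes M :: market and \<epsilon> \<delta> :: real
  assumes eps: "\<epsilon> > 0" and delta: "\<delta> > 0" and two: "num_buyers M = 2"
    and budget_pos: "i \<in> buyers M \<Longrightarrow> budget M i > 0"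
begin

lemma buyers_eq: "buyers M = {1, 2}"
  by (auto simp: buyers_def two)

definition opponents :: "nat \<Rightarrow> nat \<Rightarrow> bool" where
  "opponents i j \<longleftrightarrow> (i = 1 \<and> j = 2) \<or> (i = 2 \<and> j = 1)"

definition feasible :: "real \<Rightarrow> bool" where
  "feasible p \<longleftrightarrow> max_demand M p 1 + max_demand M p 2 \<le> units M"

text \<open>A buyer who is not hungry may receive 0, so supply is an obstacle only when both buyers
  are hungry.\<close>

lemma envy_free_price_iff:
  "envy_free_price (M\<lparr>valuation := s\<rparr>) p \<longleftrightarrow> p > 0 \<and> (s 1 \<le> p \<or> s 2 \<le> p \<or> feasible p)"
    (is "?L \<longleftrightarrow> ?R")
proof
  assume ?L
  then show ?R
    by (auto simp: envy_free_price_def envy_free_pricing_def demand_set_def buyers_eq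
        feasible_def split: if_splits)
next
  assume R: ?R
  let ?x = "\<lambda>i. if s i > p then max_demand M p i else 0"
  have "max_demand M p i \<le> units M" for i
    by (simp add: max_demand_def)
  then have "envy_free_pricing (M\<lparr>valuation := s\<rparr>) ?x p"
    using R by (auto simp: envy_free_pricing_def demand_set_def buyers_eq feasible_def)
  then show ?L
    by (auto simp: envy_free_price_def)
qed

text \<open>With both buyers reporting \<open>t\<close>, the minimum price is the least positive grid point that is at
  least \<open>t\<close> or feasible; this makes the price of a profile \<open>(a, b)\<close> equal to \<open>min (Q a) (Q b)\<close>.\<close>

definition Q :: "real \<Rightarrow> real" where
  "Q t = min_price \<delta> (M\<lparr>valuation := \<lambda>_. t\<rparr>)"

lemma Q_props: "Q t \<in> grid \<delta>" "Q t > 0" "t \<le> Q t \<or> feasible (Q t)"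
  using min_price_envy_free(1)[OF delta, of "M\<lparr>valuation := \<lambda>_. t\<rparr>"]
  by (auto simp: Q_def envy_free_price_iff)

lemma Q_least: "p \<in> grid \<delta> \<Longrightarrow> p > 0 \<Longrightarrow> t \<le> p \<or> feasible p \<Longrightarrow> Q t \<le> p"
  unfolding Q_def by (rule min_price_envy_free(2)[OF delta]) (auto simp: envy_free_price_iff)

lemma Q_mono: "t \<le> t' \<Longrightarrow> Q t \<le> Q t'"
  using Q_props[of t'] by (intro Q_least) auto

lemma Q_idem [simp]: "Q (Q t) = Q t"
  using Q_props[of t] Q_props[of "Q t"] Q_least[of "Q (Q t)" t] Q_least[of "Q t" "Q t"] by force

lemma Q_extensive_or_maximal: "x \<le> Q x \<or> Q y \<le> Q x"
  using Q_props[of x] by (meson Q_least)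

lemma Q_eq_of_small: "t \<le> Q t' \<Longrightarrow> Q t \<le> Q t'"
  using Q_mono[of t "Q t'"] by simp

lemma Q_ge_of_large: "Q t' \<le> t \<Longrightarrow> Q t' \<le> Q t"
  using Q_mono[of "Q t'" t] by simp

lemma min_price_eq:
  assumes "opponents i j"
  shows "min_price \<delta> (M\<lparr>valuation := s\<rparr>) = min (Q (s i)) (Q (s j))"
proof -
  let ?p = "min_price \<delta> (M\<lparr>valuation := s\<rparr>)"
  have p: "?p \<in> grid \<delta>" "?p > 0" "s i \<le> ?p \<or> s j \<le> ?p \<or> feasible ?p"
    using min_price_envy_free(1)[OF delta, of "M\<lparr>valuation := s\<rparr>"] assms
    by (auto simp: envy_free_price_iff opponents_def)
  have "?p \<le> Q (s k)" if "k = i \<or> k = j" for k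
    by (rule min_price_envy_free(2)[OF delta])
      (use that assms Q_props[of "s k"] in \<open>auto simp: envy_free_price_iff opponents_def\<close>)
  \<comment> \<open>Each disjunct of the envy-freeness criterion makes the price a candidate in the
    minimum that defines \<open>Q\<close> of one of the reports.\<close>
  moreover have "Q (s i) \<le> ?p \<or> Q (s j) \<le> ?p"
    using p Q_least by blast
  ultimately show ?thesis
    by (auto simp: min_def intro: antisym)
qed

section \<open>Utility of a report relative to the threshold\<close>

definition gain :: "nat \<Rightarrow> real \<Rightarrow> real" where
  "gain i p = (valuation M i - p) * real (max_demand M p i)"

lemma semi_hungry_infeasible_alloc:
  assumes "opponents i j" "s i = p" "p < s j" "\<not> feasible p"
  shows "all_or_nothing_alloc p (M\<lparr>valuation := s\<rparr>) i = 0"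
proof -
  have eq: "{k \<in> buyers M. p < s k} = {j}"
    using assms by (auto simp: buyers_eq opponents_def)
  have base: "units_left p (M\<lparr>valuation := s\<rparr>) 0 = units M - max_demand M p j"
    by (simp add: eq)
  \<comment> \<open>For \<open>i = 2\<close> the units are counted after index 1 has been processed.
    That index is the hungry buyer \<open>j\<close>, already served in the base case, so nothing
    more is deducted.\<close>
  then have "units_left p (M\<lparr>valuation := s\<rparr>) 1 = units M - max_demand M p j" if "j = 1"
    using that \<open>p < s j\<close> by simp
  then have "units_left p (M\<lparr>valuation := s\<rparr>) (i - 1) = units M - max_demand M p j"
    using base assms(1) by (auto simp: opponents_def simp del: units_left.simps)
  moreover have "units M < max_demand M p i + max_demand M p j"
    using assms(1,4) by (auto simp: opponents_def feasible_def)
  moreover have "max_demand M p j \<le> units M" "max_demand M p i \<le> affordable M p i"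
    by (auto simp: max_demand_def)
  ultimately have "\<not> affordable M p i \<le> units_left p (M\<lparr>valuation := s\<rparr>) (i - 1)"
    by linarith
  then show ?thesis
    using \<open>s i = p\<close> by (simp add: all_or_nothing_alloc_def)
qed

lemma utility_max_demand:
  assumes "p > 0" "i \<in> buyers M"
  shows "utility M i p (max_demand M p i) = ereal (gain i p)"
  using max_demand_affordable[of p M i] assms budget_pos[of i]
  by (simp add: utility_def gain_def algebra_simps)

lemma utility_nothing: "i \<in> buyers M \<Longrightarrow> utility M i p 0 = 0"
  using budget_pos[of i] by (simp add: utility_def zero_ereal_def)

lemma outcome_utility_eq:
  assumes "opponents i j"
  shows "outcome_utility \<delta> M i s =
    utility M i (min (Q (s i)) (Q (s j)))
      (all_or_nothing_alloc (min (Q (s i)) (Q (s j))) (M\<lparr>valuation := s\<rparr>) i)"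
  by (simp add: outcome_utility_def Let_def min_price_eq[OF assms])

lemma opponents_buyers: "opponents i j \<Longrightarrow> i \<in> buyers M" "opponents i j \<Longrightarrow> j \<in> buyers M"
  by (auto simp: opponents_def buyers_eq)

lemma utility_above:
  assumes "opponents i j" "Q (s j) < s i"
  shows "outcome_utility \<delta> M i s = ereal (gain i (Q (s j)))"
proof -
  have "min (Q (s i)) (Q (s j)) = Q (s j)"
    using Q_ge_of_large[of "s j" "s i"] assms by simp
  then show ?thesis
    using assms Q_props(2) opponents_buyers utility_max_demand
    by (simp add: outcome_utility_eq all_or_nothing_alloc_def)
qed

lemma utility_below:
  assumes "opponents i j" "s i < Q (s j)"
  shows "outcome_utility \<delta> M i s = 0"
proof -
  let ?p = "Q (s i)"
  have p: "min ?p (Q (s j)) = ?p"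
    using Q_eq_of_small[of "s i" "s j"] assms by simp
  have "s i \<le> ?p"
    using Q_extensive_or_maximal[of "s i" "s j"] assms by linarith
  moreover have "all_or_nothing_alloc ?p (M\<lparr>valuation := s\<rparr>) i = 0" if eq: "s i = ?p"
  proof (rule semi_hungry_infeasible_alloc[OF assms(1)])
    show "s i = ?p"
      by (fact eq)
    show "?p < s j" "\<not> feasible ?p"
      \<comment> \<open>Here \<open>?p = s i\<close> is a positive grid price below
        \<open>Q (s j)\<close>, so minimality of \<open>Q (s j)\<close> rules out both ways of being
        a candidate.\<close>
      using Q_least[of ?p "s j"] Q_props(1,2)[of "s i"] eq assms(2) by force+
  qed
  ultimately have "all_or_nothing_alloc ?p (M\<lparr>valuation := s\<rparr>) i = 0"
    by (cases "s i = ?p") (auto simp: all_or_nothing_alloc_def)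
  then show ?thesis
    using assms p opponents_buyers by (simp add: outcome_utility_eq utility_nothing)
qed

text \<open>At the tie \<open>s i = Q (s j)\<close> the lexicographic order and the units left
  decide, but all-or-nothing excludes every intermediate amount.\<close>

lemma utility_cases:
  assumes "opponents i j"
  shows "outcome_utility \<delta> M i s = 0 \<or> outcome_utility \<delta> M i s = ereal (gain i (Q (s j)))"
proof (cases "s i = Q (s j)")
  case True
  then have p: "min (Q (s i)) (Q (s j)) = Q (s j)"
    by simp
  show ?thesis
    using semi_hungry_alloc[of "M\<lparr>valuation := s\<rparr>" i "Q (s j)"] True assms Q_props(2)[of "s j"]
      opponents_buyers[OF assms]
    by (auto simp: outcome_utility_eq p utility_nothing utility_max_demand)
next
  case False
  then show ?thesis
    using utility_above[OF assms, of s] utility_below[OF assms, of s] by linarith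
qed

lemma attains_gain_or_zero:
  assumes "opponents i j"
  shows "\<exists>r\<in>grid \<epsilon>. outcome_utility \<delta> M i (s(i := r)) = ereal (gain i (Q (s j)))"
    and "\<exists>r\<in>grid \<epsilon>. outcome_utility \<delta> M i (s(i := r)) = 0"
proof -
  have ij: "i \<noteq> j"
    using assms by (auto simp: opponents_def)
  obtain r where r: "r \<in> grid \<epsilon>" "Q (s j) < r"
    using grid_unbounded[OF eps] by blast
  then show "\<exists>r\<in>grid \<epsilon>. outcome_utility \<delta> M i (s(i := r)) = ereal (gain i (Q (s j)))"
    using utility_above[OF assms, of "s(i := r)"] ij by auto
  show "\<exists>r\<in>grid \<epsilon>. outcome_utility \<delta> M i (s(i := r)) = 0"
    using utility_below[OF assms, of "s(i := 0)"] ij Q_props(2)[of "s j"] zero_in_grid by auto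
qed

text \<open>Only two utility values are possible and both are attained, by a very high report and by
  report 0, so the optimum is their maximum.\<close>

lemma best_response_utility:
  assumes "opponents i j"
  shows "best_response \<epsilon> \<delta> M i s r \<longleftrightarrow>
    r \<in> grid \<epsilon> \<and> outcome_utility \<delta> M i (s(i := r)) = ereal (max 0 (gain i (Q (s j))))"
proof -
  have ij: "i \<noteq> j"
    using assms by (auto simp: opponents_def)
  let ?u = "\<lambda>r. outcome_utility \<delta> M i (s(i := r))"
  have c: "?u r = ereal 0 \<or> ?u r = ereal (gain i (Q (s j)))" for r
    using utility_cases[OF assms, of "s(i := r)"] ij by (auto simp: zero_ereal_def)
  obtain r1 r0 where "r1 \<in> grid \<epsilon>" "?u r1 = ereal (gain i (Q (s j)))"
    and "r0 \<in> grid \<epsilon>" "?u r0 = ereal 0"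
    using attains_gain_or_zero[OF assms, of s] by (auto simp: zero_ereal_def)
  then have "(\<forall>r'\<in>grid \<epsilon>. ?u r' \<le> ?u r) \<longleftrightarrow> ?u r = ereal (max 0 (gain i (Q (s j))))"
    by (metis c ereal_less_eq(3) max.cobounded1 max.cobounded2 max_def order_antisym)
  then show ?thesis
    by (auto simp: best_response_def)
qed

lemma best_response_exists:
  assumes "opponents i j"
  shows "\<exists>r. best_response \<epsilon> \<delta> M i s r"
  using attains_gain_or_zero[OF assms, of s]
  by (auto simp: best_response_utility[OF assms] max_def zero_ereal_def)

section \<open>Improving moves and separated profiles\<close>

definition raising :: "nat \<Rightarrow> nat \<Rightarrow> (nat \<Rightarrow> real) \<Rightarrow> (nat \<Rightarrow> real) \<Rightarrow> bool" where
  "raising i j s s' \<longleftrightarrow> (\<exists>r. s' = s(i := r) \<and> Q (s j) < valuation M i \<and>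
     s i \<le> Q (s j) \<and> Q (s j) \<le> r \<and> s i < r)"

definition lowering :: "nat \<Rightarrow> nat \<Rightarrow> (nat \<Rightarrow> real) \<Rightarrow> (nat \<Rightarrow> real) \<Rightarrow> bool" where
  "lowering i j s s' \<longleftrightarrow> (\<exists>r. s' = s(i := r) \<and> valuation M i < Q (s j) \<and>
     Q (s j) \<le> s i \<and> r \<le> Q (s j) \<and> r < s i)"

text \<open>An improvement goes either from 0 to a positive gain or from a negative gain to 0. The
  sign of the gain compares the valuation with the threshold. The bounds on the two reports are weak
  because a report at the threshold may yield either value.\<close>

lemma improving_best_response:
  assumes "opponents i j" "can_improve \<epsilon> \<delta> M i s" "best_response \<epsilon> \<delta> M i s r"
  shows "raising i j s (s(i := r)) \<or> lowering i j s (s(i := r))"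
proof -
  have ij: "i \<noteq> j"
    using assms by (auto simp: opponents_def)
  let ?g = "gain i (Q (s j))"
  let ?s = "s(i := r)"
  obtain r' where r': "r' \<in> grid \<epsilon>" "outcome_utility \<delta> M i s < outcome_utility \<delta> M i (s(i := r'))"
    using assms(2) by (auto simp: can_improve_def)
  moreover have "outcome_utility \<delta> M i (s(i := r')) \<le> outcome_utility \<delta> M i ?s"
    using assms(3) r' by (auto simp: best_response_def)
  ultimately have less: "outcome_utility \<delta> M i s < outcome_utility \<delta> M i ?s"
    by order
  have u': "outcome_utility \<delta> M i ?s = ereal (max 0 ?g)"
    using assms(3) best_response_utility[OF assms(1)] by blast
  have ne: "s i \<noteq> r"
    using less by auto
  have above: "Q (s j) < s i \<Longrightarrow> outcome_utility \<delta> M i s = ereal ?g"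
    "Q (s j) < r \<Longrightarrow> outcome_utility \<delta> M i ?s = ereal ?g"
    using utility_above[OF assms(1), of s] utility_above[OF assms(1), of ?s] ij by auto
  have below: "s i < Q (s j) \<Longrightarrow> outcome_utility \<delta> M i s = ereal 0"
    "r < Q (s j) \<Longrightarrow> outcome_utility \<delta> M i ?s = ereal 0"
    using utility_below[OF assms(1), of s] utility_below[OF assms(1), of ?s] ij
    by (auto simp: zero_ereal_def)
  consider "0 < ?g" "outcome_utility \<delta> M i s = ereal 0"
    | "?g < 0" "outcome_utility \<delta> M i s = ereal ?g"
    using utility_cases[OF assms(1), of s] less u'
    by (cases "?g > 0") (auto simp: zero_ereal_def max_def split: if_splits)
  then show ?thesis
  proof cases
    case 1
    then have "s i \<le> Q (s j)" "Q (s j) \<le> r" "Q (s j) < valuation M i"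
      using above below u' by (force simp: gain_def zero_less_mult_iff)+
    then show ?thesis
      using ne by (auto simp: raising_def)
  next
    case 2
    then have "Q (s j) \<le> s i" "r \<le> Q (s j)" "valuation M i < Q (s j)"
      using above below u' by (force simp: gain_def mult_less_0_iff)+
    then show ?thesis
      using ne by (auto simp: lowering_def)
  qed
qed

text \<open>This is what forces the movers in a run to alternate.\<close>

lemma best_responder_cannot_improve:
  assumes "best_response \<epsilon> \<delta> M i s r"
  shows "\<not> can_improve \<epsilon> \<delta> M i (s(i := r))"
  using assms by (auto simp: best_response_def can_improve_def not_less)

lemma step_strategy_profile:
  "best_response_step \<epsilon> \<delta> M s s' \<Longrightarrow> strategy_profile \<epsilon> M s \<Longrightarrow> strategy_profile \<epsilon> M s'"
  by (auto simp: best_response_step_def best_response_def strategy_profile_def)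

text \<open>An invariant that fixes the direction of all later moves. The condition
  \<open>Q c = c\<close> turns the bound \<open>c \<le> s j\<close> on a report into the bound
  \<open>c \<le> Q (s j)\<close> on the threshold faced by \<open>i\<close>.\<close>

definition separated :: "nat \<Rightarrow> nat \<Rightarrow> real \<Rightarrow> (nat \<Rightarrow> real) \<Rightarrow> bool" where
  "separated i j c s \<longleftrightarrow>
     valuation M i < c \<and> c < valuation M j \<and> Q c = c \<and> c \<le> s j \<and> Q (s i) \<le> c"

text \<open>The threshold of \<open>i\<close> is at least \<open>c\<close> and hence above its
  valuation; that of \<open>j\<close> is at most \<open>c\<close> and hence below its
  valuation.\<close>

lemma separated_moves:
  assumes "separated i j c s"
  shows "\<not> raising i j s s'" "\<not> lowering j i s s'"
proof -
  have "c \<le> Q (s j)"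
    using assms Q_mono[of c "s j"] by (auto simp: separated_def)
  then show "\<not> raising i j s s'" "\<not> lowering j i s s'"
    using assms by (auto simp: separated_def raising_def lowering_def)
qed

lemma separated_step:
  assumes "opponents i j" "separated i j c s"
    and "lowering i j s s' \<or> raising j i s s'"
  shows "separated i j c s'"
proof -
  have ij: "i \<noteq> j"
    using assms by (auto simp: opponents_def)
  show ?thesis
    using assms(3)
  proof
    assume "lowering i j s s'"
    then obtain r where "s' = s(i := r)" "r < s i"
      by (auto simp: lowering_def)
    then show ?thesis
      using assms(2) ij Q_mono[of r "s i"] by (auto simp: separated_def)
  next
    assume "raising j i s s'"
    then show ?thesis
      using assms(2) ij by (auto simp: separated_def raising_def)
  qed
qed

text \<open>The threshold of \<open>i\<close> passes from below its valuation to above it, so the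
  intermediate move of \<open>j\<close> must be a raise. That raise places \<open>Q (s2 i)\<close>
  below the valuation of \<open>j\<close> and at or below its new report.\<close>

lemma raise_then_lower_separates:
  assumes "opponents i j" "raising i j s0 s1" "raising j i s1 s2 \<or> lowering j i s1 s2"
    and "lowering i j s2 s3"
  shows "separated i j (Q (s2 i)) s2"
proof -
  have ij: "i \<noteq> j"
    using assms by (auto simp: opponents_def)
  obtain r where r: "s1 = s0(i := r)" "Q (s0 j) < valuation M i" "Q (s0 j) \<le> r"
    using assms(2) by (auto simp: raising_def)
  have low: "valuation M i < Q (s2 j)" "Q (s2 j) \<le> s2 i"
    using assms(4) by (auto simp: lowering_def)
  have "\<not> lowering j i s1 s2"
  proof
    assume "lowering j i s1 s2"
    then have "s2 j \<le> s0 j"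
      using r ij by (auto simp: lowering_def)
    then show False
      using Q_mono[of "s2 j" "s0 j"] low r by linarith
  qed
  then obtain q where q: "s2 = s1(j := q)" "Q (s1 i) < valuation M j" "Q (s1 i) \<le> q"
    using assms(3) by (auto simp: raising_def)
  then have eq: "s2 i = r" "s1 i = r" "s2 j = q"
    using r ij by auto
  \<comment> \<open>If \<open>r \<le> Q r\<close>, the lowering condition \<open>Q q \<le> r\<close>
    closes the gap; otherwise \<open>Q r\<close> is maximal.\<close>
  have "Q q \<le> Q r"
    using Q_extensive_or_maximal[of r q] low eq by auto
  then show ?thesis
    using low q eq by (auto simp: separated_def)
qed

section \<open>Excluding infinite runs\<close>

lemma no_infinite_run:
  assumes prof: "strategy_profile \<epsilon> M (\<sigma> 0)"
    and step: "\<And>t::nat. best_response_step \<epsilon> \<delta> M (\<sigma> t) (\<sigma> (Suc t))"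
  shows False
proof -
  have grid: "strategy_profile \<epsilon> M (\<sigma> t)" for t
    by (induction t) (use prof step step_strategy_profile in blast)+
  have "\<exists>i. i \<in> buyers M \<and> can_improve \<epsilon> \<delta> M i (\<sigma> t) \<and>
      (\<exists>r. best_response \<epsilon> \<delta> M i (\<sigma> t) r \<and> \<sigma> (Suc t) = (\<sigma> t)(i := r))" for t
    using step[of t] unfolding best_response_step_def by blast
  then obtain \<mu> where \<mu>: "\<And>t. \<mu> t \<in> buyers M" "\<And>t. can_improve \<epsilon> \<delta> M (\<mu> t) (\<sigma> t)"
    "\<And>t. \<exists>r. best_response \<epsilon> \<delta> M (\<mu> t) (\<sigma> t) r \<and> \<sigma> (Suc t) = (\<sigma> t)(\<mu> t := r)"
    by metis
  have alt: "opponents (\<mu> t) (\<mu> (Suc t))" for t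
  proof -
    have "\<not> can_improve \<epsilon> \<delta> M (\<mu> t) (\<sigma> (Suc t))"
      using \<mu>(3)[of t] best_responder_cannot_improve by metis
    then have "\<mu> (Suc t) \<noteq> \<mu> t"
      using \<mu>(2)[of "Suc t"] by auto
    then show ?thesis
      using \<mu>(1)[of t] \<mu>(1)[of "Suc t"] by (auto simp: opponents_def buyers_eq)
  qed
  have per: "\<mu> (Suc (Suc t)) = \<mu> t" for t
    using alt[of t] alt[of "Suc t"] by (auto simp: opponents_def)
  have par: "\<mu> (T + 2 * n) = \<mu> T" for T n
    by (induction n) (auto simp: per)
  let ?up = "\<lambda>t. raising (\<mu> t) (\<mu> (Suc t)) (\<sigma> t) (\<sigma> (Suc t))"
  let ?down = "\<lambda>t. lowering (\<mu> t) (\<mu> (Suc t)) (\<sigma> t) (\<sigma> (Suc t))"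
  have move: "?up t \<or> ?down t" for t
    using \<mu>(2,3)[of t] improving_best_response[OF alt[of t]] by metis
  \<comment> \<open>A report is unchanged while the opponent moves, so the moves at times of equal
    parity chain into one sequence of reports.\<close>
  have skip: "\<sigma> (Suc (Suc t)) (\<mu> t) = \<sigma> (Suc t) (\<mu> t)" for t
    using \<mu>(3)[of "Suc t"] alt[of t] by (auto simp: opponents_def)
  have in_grid: "\<sigma> t (\<mu> T) \<in> grid \<epsilon>" for t T
    using grid[of t] \<mu>(1)[of T] by (auto simp: strategy_profile_def)
  have no_down: False if down: "\<And>n. ?down (T + 2 * n)" for T
  proof (rule no_decreasing_grid_sequence[OF eps])
    fix n
    show "\<sigma> (T + 2 * n) (\<mu> T) \<in> grid \<epsilon>"
      by (rule in_grid)
    show "\<sigma> (T + 2 * Suc n) (\<mu> T) < \<sigma> (T + 2 * n) (\<mu> T)"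
      using down[of n] skip[of "T + 2 * n"] par[of T n] by (auto simp: lowering_def)
  qed
  have no_up: False if up: "\<And>n. ?up (T + 2 * n)" for T
  proof (rule no_bounded_increasing_grid_sequence[OF eps])
    fix n
    show "\<sigma> (T + 2 * n) (\<mu> T) \<in> grid \<epsilon>"
      by (rule in_grid)
    show "\<sigma> (T + 2 * n) (\<mu> T) < \<sigma> (T + 2 * Suc n) (\<mu> T)"
      using up[of n] skip[of "T + 2 * n"] par[of T n] by (auto simp: raising_def)
    \<comment> \<open>A raise may overshoot the valuation, but the report before a raise is at most
      the threshold, which is below the valuation. Since another raise always follows, this bounds
      the whole sequence.\<close>
    show "\<sigma> (T + 2 * n) (\<mu> T) \<le> valuation M (\<mu> T)"
      using up[of n] par[of T n] by (auto simp: raising_def)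
  qed
  have not_sep: "\<not> separated (\<mu> T) (\<mu> (Suc T)) c (\<sigma> T)" for T c
  proof
    let ?i = "\<mu> T" and ?j = "\<mu> (Suc T)"
    assume 0: "separated ?i ?j c (\<sigma> T)"
    have sep: "separated ?i ?j c (\<sigma> (T + n))" for n
    proof (induction n)
      case 0
      then show ?case using \<open>separated ?i ?j c (\<sigma> T)\<close> by simp
    next
      case (Suc n)
      have "(\<mu> (T + n) = ?i \<and> \<mu> (Suc (T + n)) = ?j) \<or> (\<mu> (T + n) = ?j \<and> \<mu> (Suc (T + n)) = ?i)"
        using alt[of T] alt[of "T + n"] by (auto simp: opponents_def)
      then show ?case
        using move[of "T + n"] separated_moves[OF Suc] separated_step[OF alt[of T] Suc] by auto
    qed
    \<comment> \<open>At these times \<open>?i\<close> moves, and separation forbids it to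
      raise.\<close>
    have "?down (T + 2 * n)" for n
      using sep[of "2 * n"] separated_moves(1) move[of "T + 2 * n"] par[of T n] par[of "Suc T" n]
      by auto
    then show False
      by (rule no_down)
  qed
  \<comment> \<open>A raise followed by a lowering of the same buyer would separate the profile, so
    a single raise makes that buyer raise forever.\<close>
  have up_again: "?up (Suc (Suc t))" if "?up t" for t
  proof (rule ccontr)
    assume "\<not> ?thesis"
    then have "?down (Suc (Suc t))"
      using move by blast
    then have "separated (\<mu> t) (\<mu> (Suc t)) (Q (\<sigma> (Suc (Suc t)) (\<mu> t))) (\<sigma> (Suc (Suc t)))"
      using raise_then_lower_separates[OF alt[of t] that] move[of "Suc t"] per[of t]
        per[of "Suc t"]
      by auto
    then show False
      using not_sep[of "Suc (Suc t)"] by (simp add: per)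
  qed
  have "\<not> ?up T" for T
  proof
    assume T: "?up T"
    have "?up (T + 2 * n)" for n
    proof (induction n)
      case 0
      show ?case using T by simp
    next
      case (Suc n)
      show ?case using up_again[OF Suc] by simp
    qed
    then show False
      by (rule no_up)
  qed
  then have "?down (0 + 2 * n)" for n
    using move by blast
  then show False
    by (rule no_down)
qed

text \<open>A best response always exists, so a buyer able to improve could also take a
  step.\<close>

lemma stuck_is_equilibrium:
  assumes "strategy_profile \<epsilon> M s" "\<nexists>s'. best_response_step \<epsilon> \<delta> M s s'"
  shows "pure_nash_equilibrium \<epsilon> \<delta> M s"
proof -
  have "\<not> can_improve \<epsilon> \<delta> M i s" if "i \<in> buyers M" for i
  proof -
    obtain j where "opponents i j"
      using \<open>i \<in> buyers M\<close> by (auto simp: opponents_def buyers_eq)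
    then show ?thesis
      using best_response_exists assms(2) that unfolding best_response_step_def by blast
  qed
  then show ?thesis
    using assms(1) by (auto simp: pure_nash_equilibrium_def)
qed

end

theorem theorem1p6:
  fixes M :: market and \<epsilon> \<delta> :: real and s0 :: "nat \<Rightarrow> real"
  assumes "\<epsilon> > 0" and "\<delta> > 0"
    and "discrete_market \<epsilon> M"
    and "num_buyers M = 2"
    and "strategy_profile \<epsilon> M s0"
  shows "best_response_converges \<epsilon> \<delta> M s0"
proof -
  interpret two_buyers M \<epsilon> \<delta>
    using assms by unfold_locales (auto simp: discrete_market_def)
  have "strategy_profile \<epsilon> M s" if "(best_response_step \<epsilon> \<delta> M)\<^sup>*\<^sup>* s0 s" for s
    using that by induction (use assms(5) step_strategy_profile in blast)+
  then show ?thesis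
    unfolding best_response_converges_def
    using no_infinite_run stuck_is_equilibrium assms(5) by blast
qed

end
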